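(* Let $\mathbb{H}=\mathbb{R}^3$ be the Heisenberg group with distance $d$ and horizontal vector fields $X_1,X_2$ as in the context, and let $T>0$. Consider the autonomous vector field $$b(x)=X_1(x)+a(x)X_2(x),\qquad a(x)=\inf_{s\in\mathbb{R}}d\big((s,0,0),x\big),\qquad x\in\mathbb{H}.$$ Then $a$ is Lipschitz with respect to $d$ (so $b$ is a Lipschitz horizontal vector field), and the solution of the Cauchy problem $$\dot\gamma(t)=b(\gamma(t)),\ t\in[0,T],\qquad\gamma(0)=0,$$ is not unique: besides $\gamma(t)=(t,0,0)$ there is at least one other solution on $[0,T]$.
   Context: The Heisenberg group $\mathbb{H}$ is $\mathbb{R}^3$ with the operation $(x_1,x_2,x_3)(y_1,y_2,y_3)=(x_1+y_1,x_2+y_2,x_3+y_3+(x_1y_2-x_2y_1))$. The gauge is $\|(x_1,x_2,x_3)\|=\big((|x_1|^2+|x_2|^2)^2+|x_3|^2\big)^{1/4}$; $d(x,y)=\|x^{-1}y\|$ is a left-invariant distance. The vector fields are $X_1=\partial_1-x_2\partial_3$ and $X_2=\partial_2+x_1\partial_3$. A solution on $[0,T]$ is a continuous curve $\gamma:[0,T]\to\mathbb{H}$ with $\gamma(t)=\gamma(0)+\int_0^tb(\gamma(s))\,ds$ for every $t\in[0,T]$ (in coordinates of $\mathbb{R}^3$). *)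

theory Defs
  imports "HOL-Analysis.Analysis"
begin

definition heis_mult :: "real^3 \<Rightarrow> real^3 \<Rightarrow> real^3" (infixl "\<odot>" 70) where
  "x \<odot> y = vector [x$1 + y$1, x$2 + y$2, x$3 + y$3 + (x$1 * y$2 - x$2 * y$1)]"

text \<open>The group inverse is the Euclidean negative and the neutral element is \<open>0\<close>;
  see \<open>heis_group\<close>.\<close>

definition heis_inv :: "real^3 \<Rightarrow> real^3" where
  "heis_inv x = - x"

lemma heis_group:
  "(x \<odot> y) \<odot> z = x \<odot> (y \<odot> z)"
  "0 \<odot> x = x" "x \<odot> 0 = x"
  "heis_inv x \<odot> x = 0" "x \<odot> heis_inv x = 0"
  by (simp_all add: heis_mult_def heis_inv_def vec_eq_iff forall_3 algebra_simps)

definition heis_gauge :: "real^3 \<Rightarrow> real" where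
  "heis_gauge x = root 4 ((\<bar>x$1\<bar>\<^sup>2 + \<bar>x$2\<bar>\<^sup>2)\<^sup>2 + \<bar>x$3\<bar>\<^sup>2)"

definition heis_dist :: "real^3 \<Rightarrow> real^3 \<Rightarrow> real" where
  "heis_dist x y = heis_gauge (heis_inv x \<odot> y)"

definition heis_X1 :: "real^3 \<Rightarrow> real^3" where
  "heis_X1 x = vector [1, 0, - x$2]"

definition heis_X2 :: "real^3 \<Rightarrow> real^3" where
  "heis_X2 x = vector [0, 1, x$1]"

text \<open>Lipschitz continuity is with respect to \<open>heis_dist\<close>, not the Euclidean distance of the
  type \<open>real^3\<close>, so the library's \<open>lipschitz_on\<close> does not apply.\<close>

definition heis_lipschitz :: "(real^3 \<Rightarrow> real) \<Rightarrow> bool" where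
  "heis_lipschitz f \<longleftrightarrow> (\<exists>L\<ge>0. \<forall>x y. \<bar>f x - f y\<bar> \<le> L * heis_dist x y)"

text \<open>A horizontal vector field is Lipschitz when its (unique) coefficients in the frame
  \<open>heis_X1\<close>, \<open>heis_X2\<close> are.\<close>

definition lipschitz_horizontal_field :: "(real^3 \<Rightarrow> real^3) \<Rightarrow> bool" where
  "lipschitz_horizontal_field b \<longleftrightarrow>
     (\<exists>a1 a2. heis_lipschitz a1 \<and> heis_lipschitz a2 \<and>
        (\<forall>x. b x = a1 x *\<^sub>R heis_X1 x + a2 x *\<^sub>R heis_X2 x))"

text \<open>Integrability is required explicitly because \<open>integral\<close> is \<open>0\<close> on non-integrable functions.\<close>

definition heis_solution :: "(real^3 \<Rightarrow> real^3) \<Rightarrow> real \<Rightarrow> (real \<Rightarrow> real^3) \<Rightarrow> bool" where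
  "heis_solution b T \<gamma> \<longleftrightarrow>
     continuous_on {0..T} \<gamma> \<and>
     (\<forall>t\<in>{0..T}. (\<lambda>s. b (\<gamma> s)) integrable_on {0..t} \<and>
        \<gamma> t = \<gamma> 0 + integral {0..t} (\<lambda>s. b (\<gamma> s)))"

end

theory Submission
  imports Defs "HOL-Complex_Analysis.Great_Picard"
begin

text \<open>Along a solution with first coordinate \<open>t\<close> and second coordinate \<open>y\<close>, the quantity
  \<open>z = x\<^sub>3 - x\<^sub>1 x\<^sub>2\<close> satisfies \<open>z' = - 2 y\<close>, while \<open>y' = a\<close>. Since \<open>a\<close> is bounded below by
  \<open>sqrt \<bar>z\<bar> / 2\<close>, a lower bound \<open>y \<ge> c t\<^sup>3\<close> reproduces itself for small \<open>c\<close>: the non-uniqueness is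
  that of an equation with square root nonlinearity. A solution above this barrier is a limit of
  solutions of a delayed equation (Tonelli's scheme), by Arzela--Ascoli and dominated
  convergence. That \<open>a\<close> is Lipschitz is the triangle inequality for the gauge distance.\<close>

section \<open>The gauge distance\<close>

text \<open>Lets the rules for continuity, limits and derivatives of linear combinations apply to
  curves given by coordinates.\<close>

lemma vector_3_eq_axis_sum:
  "(vector [p, q, r] :: real^3) = p *\<^sub>R axis 1 1 + q *\<^sub>R axis 2 1 + r *\<^sub>R axis 3 1"
  by (simp add: vec_eq_iff forall_3 axis_def)

lemma root_4_eq_sqrt_sqrt: "root 4 v = sqrt (sqrt v)"
  using real_root_mult_exp[of 2 2 v] by (simp add: sqrt_def)

lemma heis_gauge_eq: "heis_gauge x = sqrt (cmod (Complex ((x$1)\<^sup>2 + (x$2)\<^sup>2) (x$3)))"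
  by (simp add: heis_gauge_def root_4_eq_sqrt_sqrt cmod_def)

lemma heis_gauge_nonneg: "0 \<le> heis_gauge x"
  by (simp add: heis_gauge_eq)

lemma heis_gauge_power2: "(heis_gauge x)\<^sup>2 = cmod (Complex ((x$1)\<^sup>2 + (x$2)\<^sup>2) (x$3))"
  by (simp add: heis_gauge_eq)

lemma heis_gauge_horizontal_le: "sqrt ((x$1)\<^sup>2 + (x$2)\<^sup>2) \<le> heis_gauge x"
  unfolding heis_gauge_eq using abs_Re_le_cmod[of "Complex ((x$1)\<^sup>2 + (x$2)\<^sup>2) (x$3)"]
  by simp

text \<open>Cygan's argument: the numbers \<open>(x\<^sub>1\<^sup>2 + x\<^sub>2\<^sup>2) + \<i> x\<^sub>3\<close>, with modulus the squared
  gauge, are additive under the group law up to a cross term of modulus at most twice the product of the horizontal norms.\<close>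

lemma heis_gauge_mult_le: "heis_gauge (x \<odot> y) \<le> heis_gauge x + heis_gauge y"
proof (rule power2_le_imp_le)
  define A where "A v = Complex ((v$1)\<^sup>2 + (v$2)\<^sup>2) (v$3)" for v :: "real^3"
  define C where "C = Complex (2 * (x$1 * y$1 + x$2 * y$2)) (x$1 * y$2 - x$2 * y$1)"
  let ?h = "\<lambda>v::real^3. sqrt ((v$1)\<^sup>2 + (v$2)\<^sup>2)"
  have eq: "A (x \<odot> y) = A x + A y + C"
    by (simp add: A_def C_def heis_mult_def complex_eq_iff power2_eq_square algebra_simps)
  have "cmod C = sqrt ((2 * (x$1 * y$1 + x$2 * y$2))\<^sup>2 + (x$1 * y$2 - x$2 * y$1)\<^sup>2)"
    by (simp add: C_def cmod_def)
  also have "\<dots> \<le> sqrt (4 * (((x$1)\<^sup>2 + (x$2)\<^sup>2) * ((y$1)\<^sup>2 + (y$2)\<^sup>2)))"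
  proof (rule real_sqrt_le_mono)
    \<comment> \<open>Lagrange's identity: the product of the squared horizontal norms is the
      squared inner product plus the squared symplectic form.\<close>
    have "4 * (((x$1)\<^sup>2 + (x$2)\<^sup>2) * ((y$1)\<^sup>2 + (y$2)\<^sup>2))
        = (2 * (x$1 * y$1 + x$2 * y$2))\<^sup>2 + (x$1 * y$2 - x$2 * y$1)\<^sup>2
          + 3 * (x$1 * y$2 - x$2 * y$1)\<^sup>2"
      by (simp add: power2_eq_square algebra_simps)
    then show "(2 * (x$1 * y$1 + x$2 * y$2))\<^sup>2 + (x$1 * y$2 - x$2 * y$1)\<^sup>2
        \<le> 4 * (((x$1)\<^sup>2 + (x$2)\<^sup>2) * ((y$1)\<^sup>2 + (y$2)\<^sup>2))"
      by simp
  qed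
  also have "\<dots> = 2 * (?h x * ?h y)"
    by (simp add: real_sqrt_mult)
  also have "\<dots> \<le> 2 * (heis_gauge x * heis_gauge y)"
    using heis_gauge_horizontal_le[of x] heis_gauge_horizontal_le[of y]
    by (simp add: mult_mono heis_gauge_nonneg)
  finally have C: "cmod C \<le> 2 * (heis_gauge x * heis_gauge y)" .
  have "(heis_gauge (x \<odot> y))\<^sup>2 = cmod (A x + A y + C)"
    by (simp add: heis_gauge_power2 flip: A_def eq)
  also have "\<dots> \<le> cmod (A x) + cmod (A y) + cmod C"
    by (meson add_mono_thms_linordered_semiring(3) norm_triangle_ineq order_trans)
  also have "\<dots> \<le> (heis_gauge x)\<^sup>2 + (heis_gauge y)\<^sup>2 + 2 * (heis_gauge x * heis_gauge y)"
    using C by (simp add: heis_gauge_power2 A_def)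
  also have "\<dots> = (heis_gauge x + heis_gauge y)\<^sup>2"
    by (simp add: power2_eq_square algebra_simps)
  finally show "(heis_gauge (x \<odot> y))\<^sup>2 \<le> (heis_gauge x + heis_gauge y)\<^sup>2" .
qed (simp add: heis_gauge_nonneg)

lemma heis_dist_nonneg: "0 \<le> heis_dist x y"
  by (simp add: heis_dist_def heis_gauge_nonneg)

lemma heis_dist_refl: "heis_dist x x = 0"
  by (simp add: heis_dist_def heis_group heis_gauge_def)

lemma heis_dist_commute: "heis_dist x y = heis_dist y x"
proof -
  have "heis_inv x \<odot> y = - (heis_inv y \<odot> x)"
    by (simp add: heis_mult_def heis_inv_def vec_eq_iff forall_3 algebra_simps)
  then show ?thesis
    by (simp add: heis_dist_def heis_gauge_def)
qed

lemma heis_dist_triangle: "heis_dist x z \<le> heis_dist x y + heis_dist y z"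
proof -
  have "heis_inv x \<odot> z = (heis_inv x \<odot> y) \<odot> (heis_inv y \<odot> z)"
    by (simp add: heis_mult_def heis_inv_def vec_eq_iff forall_3 algebra_simps)
  then show ?thesis
    by (simp add: heis_dist_def heis_gauge_mult_le)
qed

lemma continuous_on_heis_dist: "continuous_on S (\<lambda>y. heis_dist x y)"
  unfolding heis_dist_def heis_gauge_def heis_mult_def heis_inv_def
  by (simp, intro continuous_intros)


section \<open>The distance from the first axis\<close>

definition axis_dist :: "real^3 \<Rightarrow> real" where
  "axis_dist x = (INF s::real. heis_dist (vector [s, 0, 0]) x)"

lemma axis_dist_le: "axis_dist x \<le> heis_dist (vector [s, 0, 0]) x"
  unfolding axis_dist_def
  by (rule cINF_lower) (auto intro!: bdd_belowI2[where m=0] heis_dist_nonneg)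

lemma axis_dist_geI: "(\<And>s. m \<le> heis_dist (vector [s, 0, 0]) x) \<Longrightarrow> m \<le> axis_dist x"
  unfolding axis_dist_def by (rule cINF_greatest) auto

lemma axis_dist_axis: "axis_dist (vector [t, 0, 0]) = 0"
  using axis_dist_le[of "vector [t, 0, 0]" t]
  by (intro antisym axis_dist_geI heis_dist_nonneg) (simp add: heis_dist_refl)

text \<open>An infimum of functions that are 1-Lipschitz for \<open>heis_dist\<close> is again
  1-Lipschitz.\<close>

lemma axis_dist_diff_le: "\<bar>axis_dist x - axis_dist y\<bar> \<le> heis_dist x y"
proof -
  have *: "axis_dist u - heis_dist u v \<le> axis_dist v" for u v
    using axis_dist_le[of u] heis_dist_triangle[of _ u v] heis_dist_commute[of u v]
    by (intro axis_dist_geI) (smt (verit, best))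
  show ?thesis
    using *[of x y] *[of y x] by (simp add: heis_dist_commute[of y x])
qed

lemma heis_lipschitz_axis_dist: "heis_lipschitz axis_dist"
  unfolding heis_lipschitz_def by (rule exI[of _ 1]) (simp add: axis_dist_diff_le)

text \<open>This is Euclidean continuity. It follows from the Lipschitz bound because
  \<open>heis_dist x\<close> is Euclidean continuous and vanishes at \<open>x\<close>.\<close>

lemma continuous_on_axis_dist: "continuous_on S axis_dist"
proof -
  have "(axis_dist \<longlongrightarrow> axis_dist x) (at x)" for x
  proof -
    have "((\<lambda>y. heis_dist x y) \<longlongrightarrow> heis_dist x x) (at x)"
      using continuous_on_heis_dist[of UNIV x] by (simp add: continuous_on_def)
    then have "((\<lambda>y. heis_dist x y) \<longlongrightarrow> 0) (at x)"
      by (simp add: heis_dist_refl)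
    then have "((\<lambda>y. axis_dist y - axis_dist x) \<longlongrightarrow> 0) (at x)"
      by (rule Lim_null_comparison[rotated])
         (simp add: axis_dist_diff_le abs_minus_commute[of "axis_dist _" "axis_dist x"])
    then show ?thesis
      using LIM_zero_iff by blast
  qed
  then have "continuous_on UNIV axis_dist"
    by (simp add: continuous_on_def)
  then show ?thesis
    using continuous_on_subset by blast
qed

lemma heis_dist_axis_eq:
  "heis_dist (vector [s, 0, 0]) x = sqrt (sqrt (((x$1 - s)\<^sup>2 + (x$2)\<^sup>2)\<^sup>2 + (x$3 - s * x$2)\<^sup>2))"
  by (simp add: heis_dist_def heis_gauge_def heis_mult_def heis_inv_def root_4_eq_sqrt_sqrt
        algebra_simps)

lemma axis_dist_upper: "axis_dist x \<le> \<bar>x$2\<bar> + sqrt \<bar>x$3 - x$1 * x$2\<bar>"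
proof -
  let ?z = "x$3 - x$1 * x$2"
  \<comment> \<open>The competitor is the axis point with the same first coordinate as
    \<open>x\<close>.\<close>
  have "axis_dist x \<le> sqrt (sqrt (((x$2)\<^sup>2)\<^sup>2 + ?z\<^sup>2))"
    using axis_dist_le[of x "x$1"] by (simp add: heis_dist_axis_eq)
  also have "\<dots> \<le> sqrt ((x$2)\<^sup>2 + \<bar>?z\<bar>)"
    using sqrt_sum_squares_le_sum_abs[of "(x$2)\<^sup>2" ?z] by simp
  also have "\<dots> \<le> \<bar>x$2\<bar> + sqrt \<bar>?z\<bar>"
    using sqrt_add_le_add_sqrt[of "(x$2)\<^sup>2" "\<bar>?z\<bar>"] by simp
  finally show ?thesis .
qed

lemma axis_dist_lower: "sqrt \<bar>x$3 - x$1 * x$2\<bar> / 2 \<le> axis_dist x"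
proof (rule axis_dist_geI)
  fix s
  define u y z where "u = x$1 - s" and "y = x$2" and "z = x$3 - x$1 * x$2"
  \<comment> \<open>A sum of squares certificate; \<open>z/4\<close> produces the factor 1/2 of the
    claim after the outer square root.\<close>
  have "(u\<^sup>2 + y\<^sup>2)\<^sup>2 + (z + u * y)\<^sup>2 - (z/4)\<^sup>2
      = (u\<^sup>2 - y\<^sup>2)\<^sup>2 + 5 * (u * y + z/5)\<^sup>2 + (59/80) * z\<^sup>2"
    by (simp add: power2_eq_square field_simps)
  then have "(z/4)\<^sup>2 \<le> (u\<^sup>2 + y\<^sup>2)\<^sup>2 + (z + u * y)\<^sup>2"
    by (smt (verit, best) mult_nonneg_nonneg zero_le_divide_iff zero_le_power2)
  then have "\<bar>z\<bar> / 4 \<le> sqrt ((u\<^sup>2 + y\<^sup>2)\<^sup>2 + (z + u * y)\<^sup>2)"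
    by (intro real_le_rsqrt) (simp add: power_divide)
  then have "sqrt (\<bar>z\<bar> / 4) \<le> sqrt (sqrt ((u\<^sup>2 + y\<^sup>2)\<^sup>2 + (z + u * y)\<^sup>2))"
    by simp
  moreover have "x$3 - s * x$2 = z + u * y"
    by (simp add: u_def y_def z_def algebra_simps)
  ultimately show "sqrt \<bar>x$3 - x$1 * x$2\<bar> / 2 \<le> heis_dist (vector [s, 0, 0]) x"
    by (simp add: heis_dist_axis_eq real_sqrt_divide y_def flip: u_def z_def)
qed


section \<open>Lifted curves and the delayed equation\<close>

text \<open>When the first two coordinates are \<open>t\<close> and \<open>y\<close>, the field
  forces the third to have derivative \<open>t * y' - y\<close>. Integration by parts from 0 gives
  the last entry, so only \<open>y\<close> remains unknown.\<close>

definition lift :: "(real \<Rightarrow> real) \<Rightarrow> real \<Rightarrow> real^3" where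
  "lift y t = vector [t, y t, t * y t - 2 * integral {0..t} y]"

text \<open>The fixed point equation is a scalar form of the Cauchy problem from 0, nonlocal because
  \<open>lift\<close> contains the running integral of \<open>y\<close>.\<close>

definition picard :: "(real \<Rightarrow> real) \<Rightarrow> real \<Rightarrow> real" where
  "picard y t = integral {0..t} (\<lambda>s. axis_dist (lift y s))"

text \<open>The cubic lower barrier keeps the limit away from the trivial solution. It is self-improving:
  \<open>y \<ge> c t\<^sup>3\<close> gives \<open>picard y \<ge> sqrt (c/2) t\<^sup>3 / 6\<close>, which is at least \<open>4 c t\<^sup>3\<close> for \<open>c \<le> 1/1152\<close>.\<close>

definition admissible :: "real \<Rightarrow> (real \<Rightarrow> real) \<Rightarrow> bool" where
  "admissible T y \<longleftrightarrow> (\<forall>t\<in>{0..T}. t ^ 3 / 1152 \<le> y t \<and> y t \<le> exp (2 * t))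
     \<and> (2 * exp (2 * T))-lipschitz_on {0..T} y"

lemma admissible_continuous_on:
  "admissible T y \<Longrightarrow> t \<le> T \<Longrightarrow> continuous_on {0..t} y"
  unfolding admissible_def
  by (rule continuous_on_subset[of "{0..T}"]) (auto intro: lipschitz_on_continuous_on)

lemma continuous_on_lift:
  assumes "continuous_on {0..t} y"
  shows "continuous_on {0..t} (lift y)"
  unfolding lift_def vector_3_eq_axis_sum
  by (intro continuous_intros assms indefinite_integral_continuous_1 integrable_continuous_real)

lemma continuous_on_axis_dist_lift:
  assumes "continuous_on {0..t} y"
  shows "continuous_on {0..t} (\<lambda>s. axis_dist (lift y s))"
  using continuous_on_compose2[OF continuous_on_axis_dist[of UNIV] continuous_on_lift[OF assms]]
  by simp

section \<open>A priori bounds for the integral operator\<close>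

lemma has_integral_power_Icc:
  assumes "0 \<le> t"
  shows "((\<lambda>s::real. s ^ n) has_integral t ^ Suc n / Suc n) {0..t}"
proof -
  have "((\<lambda>s. s ^ Suc n / Suc n) has_real_derivative s ^ n) (at s within {0..t})" for s :: real
    using DERIV_cdivide[OF DERIV_pow[of "Suc n" s "{0..t}"], of "real (Suc n)"] by simp
  then show ?thesis
    using fundamental_theorem_of_calculus[OF assms, of "\<lambda>s. s ^ Suc n / Suc n" "\<lambda>s. s ^ n"]
    by (simp add: has_real_derivative_iff_has_vector_derivative)
qed

lemma has_integral_exp_2_Icc:
  assumes "0 \<le> t"
  shows "((\<lambda>s::real. exp (2 * s)) has_integral (exp (2 * t) - 1) / 2) {0..t}"
proof -
  have "((\<lambda>s. exp (2 * s) / 2) has_real_derivative exp (2 * s)) (at s within {0..t})" for s :: real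
    by (auto intro!: derivative_eq_intros)
  then show ?thesis
    using fundamental_theorem_of_calculus[OF assms, of "\<lambda>s. exp (2 * s) / 2" "\<lambda>s. exp (2 * s)"]
    by (simp add: has_real_derivative_iff_has_vector_derivative diff_divide_distrib)
qed

lemma integral_admissible_bounds:
  assumes "admissible T y" "t \<in> {0..T}"
  shows "t ^ 4 / 4608 \<le> integral {0..t} y" "integral {0..t} y \<le> (exp (2 * t) - 1) / 2"
proof -
  have y: "(y has_integral integral {0..t} y) {0..t}"
    using assms by (intro integrable_integral integrable_continuous_real admissible_continuous_on) auto
  have lo: "((\<lambda>s. s ^ 3 / 1152) has_integral t ^ 4 / 4608) {0..t}"
    using has_integral_divide[OF has_integral_power_Icc[of t 3], of 1152] assms
    by simp
  show "t ^ 4 / 4608 \<le> integral {0..t} y"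
    using assms by (intro has_integral_le[OF lo y]) (auto simp: admissible_def)
  show "integral {0..t} y \<le> (exp (2 * t) - 1) / 2"
    using assms by (intro has_integral_le[OF y has_integral_exp_2_Icc]) (auto simp: admissible_def)
qed

text \<open>With \<open>I\<close> the integral of \<open>y\<close>, the lower bound is half the root
  of \<open>2 * I\<close>, which is at least \<open>(t\<^sup>2 / 48)\<^sup>2\<close>. For the upper
  bound, both \<open>y t\<close> and the root of \<open>2 * I\<close> are at most
  \<open>exp (2 * t)\<close>.\<close>

lemma axis_dist_lift_bounds:
  assumes "admissible T y" "t \<in> {0..T}"
  shows "t\<^sup>2 / 96 \<le> axis_dist (lift y t)" "axis_dist (lift y t) \<le> 2 * exp (2 * t)"
proof -
  define I where "I = integral {0..t} y"
  note I = integral_admissible_bounds[OF assms, folded I_def]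
  have "0 \<le> t ^ 4 / 4608"
    by simp
  then have I0: "0 \<le> I"
    using I(1) by linarith
  have z: "\<bar>lift y t $ 3 - lift y t $ 1 * lift y t $ 2\<bar> = 2 * I"
    using I0 by (simp add: lift_def I_def)
  have "(t\<^sup>2 / 48)\<^sup>2 \<le> 2 * I"
    using I(1) by (simp add: power_divide flip: power_mult)
  then have "t\<^sup>2 / 48 \<le> sqrt (2 * I)"
    by (rule real_le_rsqrt)
  then show "t\<^sup>2 / 96 \<le> axis_dist (lift y t)"
    using axis_dist_lower[of "lift y t"] by (simp only: z)
  have "0 \<le> t ^ 3 / 1152" "t ^ 3 / 1152 \<le> y t"
    using assms by (auto simp: admissible_def)
  then have "0 \<le> y t"
    by (rule order_trans)
  have "2 * I \<le> exp (2 * t)"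
    using I(2) by simp
  also have "\<dots> \<le> (exp (2 * t))\<^sup>2"
    using assms by (intro self_le_power) auto
  finally have "sqrt (2 * I) \<le> exp (2 * t)"
    by (intro real_le_lsqrt) auto
  moreover have "\<bar>lift y t $ 2\<bar> \<le> exp (2 * t)"
    using \<open>0 \<le> y t\<close> assms by (simp add: lift_def admissible_def)
  ultimately show "axis_dist (lift y t) \<le> 2 * exp (2 * t)"
    using axis_dist_upper[of "lift y t"] by (simp only: z)
qed

lemma axis_dist_lift_has_integral_picard:
  assumes "admissible T y" "t \<le> T"
  shows "((\<lambda>s. axis_dist (lift y s)) has_integral picard y t) {0..t}"
  unfolding picard_def
  by (intro integrable_integral integrable_continuous_real continuous_on_axis_dist_lift
        admissible_continuous_on[OF assms])

text \<open>Both bounds improve on admissibility: the lower one by a factor 4, the upper one by 1.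
  This slack pays for the delay.\<close>

lemma picard_bounds:
  assumes "admissible T y" "t \<in> {0..T}"
  shows "t ^ 3 / 288 \<le> picard y t" "picard y t \<le> exp (2 * t) - 1"
proof -
  have F: "((\<lambda>s. axis_dist (lift y s)) has_integral picard y t) {0..t}"
    using assms by (intro axis_dist_lift_has_integral_picard) auto
  have lo: "((\<lambda>s. s\<^sup>2 / 96) has_integral t ^ 3 / 288) {0..t}"
    using has_integral_divide[OF has_integral_power_Icc[of t 2], of 96] assms by simp
  have hi: "((\<lambda>s. 2 * exp (2 * s)) has_integral exp (2 * t) - 1) {0..t}"
    using has_integral_mult_right[OF has_integral_exp_2_Icc[of t], of 2] assms
    by (simp add: diff_divide_distrib)
  show "t ^ 3 / 288 \<le> picard y t"
    using axis_dist_lift_bounds(1)[OF assms(1)] assms(2) by (intro has_integral_le[OF lo F]) auto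
  show "picard y t \<le> exp (2 * t) - 1"
    using axis_dist_lift_bounds(2)[OF assms(1)] assms(2) by (intro has_integral_le[OF F hi]) auto
qed

lemma axis_dist_nonneg: "0 \<le> axis_dist x"
  by (intro axis_dist_geI heis_dist_nonneg)

lemma axis_dist_lift_le:
  assumes "admissible T y" "t \<in> {0..T}"
  shows "axis_dist (lift y t) \<le> 2 * exp (2 * T)"
proof -
  have "axis_dist (lift y t) \<le> 2 * exp (2 * t)"
    using assms by (rule axis_dist_lift_bounds)
  also have "\<dots> \<le> 2 * exp (2 * T)"
    using assms by simp
  finally show ?thesis .
qed

lemma lipschitz_on_picard:
  assumes "admissible T y"
  shows "(2 * exp (2 * T))-lipschitz_on {0..T} (picard y)"
proof (rule lipschitz_on_leI)
  fix s t :: real assume st: "s \<in> {0..T}" "t \<in> {0..T}" "s \<le> t"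
  have int: "(\<lambda>s. axis_dist (lift y s)) integrable_on {0..t}"
    using axis_dist_lift_has_integral_picard[OF assms, of t] st by auto
  have "picard y t - picard y s = integral {s..t} (\<lambda>s. axis_dist (lift y s))"
    using Henstock_Kurzweil_Integration.integral_combine[OF _ _ int, of s] st
    by (simp add: picard_def)
  also have "norm \<dots> \<le> 2 * exp (2 * T) * (t - s)"
    using st assms
    by (intro integral_bound continuous_on_subset[OF continuous_on_axis_dist_lift[OF
            admissible_continuous_on[OF assms order_refl]]])
       (auto simp: axis_dist_nonneg axis_dist_lift_le)
  finally show "dist (picard y s) (picard y t) \<le> 2 * exp (2 * T) * dist s t"
    using st by (simp add: dist_real_def abs_minus_commute)
qed simp

section \<open>The delayed equation\<close>

text \<open>The delay makes the fixed point problem solvable step by step; the constant \<open>d\<^sup>3 / 288\<close>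
  compensates for the loss that the delay causes in the cubic lower barrier.\<close>

definition delayed_picard :: "real \<Rightarrow> (real \<Rightarrow> real) \<Rightarrow> real \<Rightarrow> real" where
  "delayed_picard d y t = d ^ 3 / 288 + picard y (max 0 (t - d))"

text \<open>Convexity of the cube; its constant 4 is the factor gained in
  \<open>picard_bounds\<close>.\<close>

lemma power3_add_le: "0 \<le> u \<Longrightarrow> 0 \<le> v \<Longrightarrow> (u + v) ^ 3 \<le> 4 * (u ^ 3 + v ^ 3)" for u v :: real
proof -
  assume "0 \<le> u" "0 \<le> v"
  have "4 * (u ^ 3 + v ^ 3) - (u + v) ^ 3 = 3 * ((u + v) * (u - v)\<^sup>2)"
    by (simp add: power3_eq_cube power2_eq_square algebra_simps)
  moreover have "0 \<le> (u + v) * (u - v)\<^sup>2"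
    using \<open>0 \<le> u\<close> \<open>0 \<le> v\<close> by simp
  ultimately show ?thesis by simp
qed

lemma admissible_delayed_picard:
  assumes y: "admissible T y" and d: "0 < d" "d \<le> 1"
  shows "admissible T (delayed_picard d y)"
  unfolding admissible_def
proof (intro conjI ballI)
  fix t assume t: "t \<in> {0..T}"
  define r where "r = max 0 (t - d)"
  have r: "r \<in> {0..T}" "r \<le> t" "t \<le> d + r"
    using t d by (auto simp: r_def)
  \<comment> \<open>Splitting \<open>t\<close> into delay and remainder costs a factor 4, and
    \<open>1152 = 4 * 288\<close>.\<close>
  have "t ^ 3 \<le> (d + r) ^ 3"
    using r t by (intro power_mono) auto
  also have "\<dots> \<le> 4 * (d ^ 3 + r ^ 3)"
    using d r by (intro power3_add_le) auto
  finally show "t ^ 3 / 1152 \<le> delayed_picard d y t"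
    using picard_bounds(1)[OF y r(1)] by (simp add: delayed_picard_def flip: r_def)
  have "d ^ 3 \<le> 1"
    using d by (simp add: power_le_one)
  moreover have "exp (2 * r) \<le> exp (2 * t)"
    using r by simp
  ultimately show "delayed_picard d y t \<le> exp (2 * t)"
    using picard_bounds(2)[OF y r(1)] unfolding delayed_picard_def r_def[symmetric] by linarith
next
  show "(2 * exp (2 * T))-lipschitz_on {0..T} (delayed_picard d y)"
  proof (rule lipschitz_onI)
    fix s t assume st: "s \<in> {0..T}" "t \<in> {0..T}"
    have "dist (delayed_picard d y s) (delayed_picard d y t)
        = dist (picard y (max 0 (s - d))) (picard y (max 0 (t - d)))"
      by (simp add: delayed_picard_def dist_real_def)
    also have "\<dots> \<le> 2 * exp (2 * T) * dist (max 0 (s - d)) (max 0 (t - d))"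
      using st d by (intro lipschitz_onD[OF lipschitz_on_picard[OF y]]) auto
    also have "\<dots> \<le> 2 * exp (2 * T) * dist s t"
      by (intro mult_left_mono) (auto simp: dist_real_def)
    finally show "dist (delayed_picard d y s) (delayed_picard d y t) \<le> 2 * exp (2 * T) * dist s t" .
  qed simp
qed

text \<open>Causality: only the past of \<open>y\<close> up to \<open>t\<close> enters.\<close>

lemma picard_cong:
  assumes "\<And>s. s \<in> {0..t} \<Longrightarrow> y s = y' s"
  shows "picard y t = picard y' t"
proof -
  have "integral {0..s} y = integral {0..s} y'" if "s \<in> {0..t}" for s
    using that assms by (intro integral_cong) auto
  then show ?thesis
    unfolding picard_def by (intro integral_cong) (use assms in \<open>auto simp: lift_def\<close>)
qed

text \<open>By causality the delayed operator at \<open>t\<close> sees its argument only up to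
  \<open>max 0 (t - d)\<close>, so each iteration lengthens the interval of agreement by
  \<open>d\<close>. The count starts at one application, which fixes the value
  \<open>d ^ 3 / 288\<close> at 0 whatever \<open>y\<close> is.\<close>

lemma delayed_picard_iterates_stabilise:
  assumes "0 < d" "0 \<le> t" "t \<le> real k * d"
  shows "(delayed_picard d ^^ Suc (Suc k)) y t = (delayed_picard d ^^ Suc k) y t"
  using assms(2,3)
proof (induction k arbitrary: t)
  case 0
  then show ?case
    using assms(1) by (simp add: delayed_picard_def picard_def)
next
  case (Suc k)
  have "picard ((delayed_picard d ^^ Suc (Suc k)) y) (max 0 (t - d))
      = picard ((delayed_picard d ^^ Suc k) y) (max 0 (t - d))"
    using Suc.prems assms(1) by (intro picard_cong Suc.IH) (auto simp: algebra_simps max_def split: if_splits)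
  then show ?case
    by (simp add: delayed_picard_def[of d _ t])
qed

text \<open>Supplies the starting point of the iteration.\<close>

lemma admissible_exp: "admissible T (\<lambda>t. exp (2 * t))"
  unfolding admissible_def
proof (intro conjI ballI)
  fix t assume "t \<in> {0..T}"
  \<comment> \<open>Cubing this linear bound yields a cubic bound for
    \<open>exp (2 * t)\<close>.\<close>
  moreover have "2 * t / 3 \<le> exp (2 * t / 3)"
    using exp_ge_add_one_self[of "2 * t / 3"] by linarith
  ultimately have "(2 * t / 3) ^ 3 \<le> exp (2 * t / 3) ^ 3"
    by (intro power_mono) auto
  also have "\<dots> = exp (2 * t)"
    by (subst exp_of_nat_mult[symmetric]) simp
  finally have "8 / 27 * t ^ 3 \<le> exp (2 * t)"
    by (simp add: power_divide power_mult_distrib)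
  moreover have "0 \<le> t ^ 3"
    using \<open>t \<in> {0..T}\<close> by simp
  ultimately show "t ^ 3 / 1152 \<le> exp (2 * t)"
    by linarith
next
  show "(2 * exp (2 * T))-lipschitz_on {0..T} (\<lambda>t. exp (2 * t))"
  proof (rule lipschitz_on_leI)
    fix s t assume st: "s \<in> {0..T}" "t \<in> {0..T}" "s \<le> t"
    have "exp (2 * t) - exp (2 * s) = exp (2 * t) * (1 - exp (2 * s - 2 * t))"
      by (simp add: right_diff_distrib flip: exp_add)
    also have "\<dots> \<le> exp (2 * T) * (2 * t - 2 * s)"
    proof (rule mult_mono)
      show "1 - exp (2 * s - 2 * t) \<le> 2 * t - 2 * s"
        using exp_ge_add_one_self[of "2 * s - 2 * t"] by linarith
    qed (use st in auto)
    finally show "dist (exp (2 * s)) (exp (2 * t)) \<le> 2 * exp (2 * T) * dist s t"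
      using st by (simp add: dist_real_def algebra_simps)
  qed simp
qed simp

lemma ex_delayed_fixed_point:
  assumes d: "0 < d" "d \<le> 1"
  shows "\<exists>y. admissible T y \<and> (\<forall>t\<in>{0..T}. y t = delayed_picard d y t)"
proof -
  \<comment> \<open>After this many steps of length \<open>d\<close> the interval of agreement
    covers \<open>{0..T}\<close>.\<close>
  define N where "N = nat \<lceil>T / d\<rceil>"
  define y where "y = (delayed_picard d ^^ Suc N) (\<lambda>t. exp (2 * t))"
  have "admissible T ((delayed_picard d ^^ n) (\<lambda>t. exp (2 * t)))" for n
    by (induction n) (simp_all add: admissible_exp admissible_delayed_picard d)
  moreover have "y t = delayed_picard d y t" if "t \<in> {0..T}" for t
  proof -
    have "T / d \<le> real N"
      by (simp add: N_def real_nat_ceiling_ge)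
    then have "t \<le> real N * d"
      using d that by (simp add: field_simps)
    then show ?thesis
      using delayed_picard_iterates_stabilise[of d t N "\<lambda>t. exp (2 * t)"] d that
      by (simp add: y_def)
  qed
  ultimately show ?thesis
    unfolding y_def by blast
qed

section \<open>Passage to the limit of vanishing delay\<close>

text \<open>Dominated convergence is applied twice: to the running integrals inside
  \<open>lift\<close>, then to the outer integral.\<close>

lemma tendsto_picard:
  assumes Y: "\<And>n. admissible T (Y n)" and y: "admissible T y"
    and lim: "\<And>t. t \<in> {0..T} \<Longrightarrow> (\<lambda>n. Y n t) \<longlonglongrightarrow> y t"
    and t: "t \<in> {0..T}"
  shows "(\<lambda>n. picard (Y n) t) \<longlonglongrightarrow> picard y t"
proof -
  have int: "(\<lambda>n. integral {0..s} (Y n)) \<longlonglongrightarrow> integral {0..s} y" if s: "s \<in> {0..T}" for s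
  proof (rule dominated_convergence(2)[where h = "\<lambda>s. exp (2 * s)"])
    show "Y n integrable_on {0..s}" for n
      using s by (intro integrable_continuous_real admissible_continuous_on[OF Y]) auto
    show "(\<lambda>s. exp (2 * s)) integrable_on {0..s}"
      using s has_integral_exp_2_Icc by auto
    show "norm (Y n r) \<le> exp (2 * r)" if "r \<in> {0..s}" for n r
    proof -
      have "r \<in> {0..T}" using that s by auto
      then have "r ^ 3 / 1152 \<le> Y n r" "Y n r \<le> exp (2 * r)"
        using Y by (auto simp: admissible_def)
      moreover have "0 \<le> r ^ 3 / 1152" using that by simp
      ultimately show ?thesis unfolding real_norm_def by linarith
    qed
    show "(\<lambda>n. Y n r) \<longlonglongrightarrow> y r" if "r \<in> {0..s}" for r
      using that s by (intro lim) auto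
  qed
  show ?thesis
    unfolding picard_def
  proof (rule dominated_convergence(2)[where h = "\<lambda>_. 2 * exp (2 * T)"])
    show "(\<lambda>s. axis_dist (lift (Y n) s)) integrable_on {0..t}" for n
      using axis_dist_lift_has_integral_picard[OF Y, of t n] t by auto
    show "norm (axis_dist (lift (Y n) s)) \<le> 2 * exp (2 * T)" if "s \<in> {0..t}" for n s
      using that t axis_dist_lift_le[OF Y, of s n] by (simp add: axis_dist_nonneg)
    show "(\<lambda>n. axis_dist (lift (Y n) s)) \<longlonglongrightarrow> axis_dist (lift y s)" if "s \<in> {0..t}" for s
    proof -
      have "(\<lambda>n. lift (Y n) s) \<longlonglongrightarrow> lift y s"
        unfolding lift_def vector_3_eq_axis_sum
        using that t by (intro tendsto_intros lim int) auto
      then show ?thesis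
        using continuous_on_tendsto_compose[OF continuous_on_axis_dist[of UNIV]] by simp
    qed
  qed auto
qed

lemma ex_picard_fixed_point:
  obtains y where "admissible T y" "\<And>t. t \<in> {0..T} \<Longrightarrow> y t = picard y t"
proof -
  let ?L = "2 * exp (2 * T)"
  define d where "d n = inverse (real (Suc n))" for n
  have d: "0 < d n" "d n \<le> 1" for n
    by (auto simp: d_def divide_simps)
  obtain Y where Y: "\<And>n. admissible T (Y n)"
    and Y_eq: "\<And>n t. t \<in> {0..T} \<Longrightarrow> Y n t = delayed_picard (d n) (Y n) t"
    using ex_delayed_fixed_point[OF d] by metis
  have bnd: "t ^ 3 / 1152 \<le> Y n t" "Y n t \<le> exp (2 * t)" if "t \<in> {0..T}" for n t
    using Y that by (auto simp: admissible_def)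
  have lip: "dist (Y n s) (Y n t) \<le> ?L * dist s t" if "s \<in> {0..T}" "t \<in> {0..T}" for n s t
    using Y[of n] that by (auto simp: admissible_def intro: lipschitz_onD)
  have bound: "norm (Y n t) \<le> exp (2 * T)" if "t \<in> {0..T}" for n t
  proof -
    have "0 \<le> t ^ 3 / 1152" "exp (2 * t) \<le> exp (2 * T)"
      using that by auto
    then show ?thesis
      using bnd[OF that, of n] unfolding real_norm_def by linarith
  qed
  \<comment> \<open>The common Lipschitz constant gives a radius independent of
    \<open>n\<close>.\<close>
  have equicont: "\<exists>r>0. \<forall>n t. t \<in> {0..T} \<and> norm (s - t) < r \<longrightarrow> norm (Y n s - Y n t) < e"
    if "s \<in> {0..T}" "0 < e" for s e
  proof (intro exI[of _ "e / ?L"] conjI allI impI)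
    fix n t assume t: "t \<in> {0..T} \<and> norm (s - t) < e / ?L"
    have "norm (Y n s - Y n t) \<le> ?L * norm (s - t)"
      using lip[of s t n] that t by (simp add: dist_norm)
    also have "\<dots> < e"
      using t by (simp add: field_simps)
    finally show "norm (Y n s - Y n t) < e" .
  qed (use that in simp)
  have "\<exists>y k. strict_mono (k :: nat \<Rightarrow> nat)
      \<and> (\<forall>e>0. \<exists>N. \<forall>n t. n \<ge> N \<and> t \<in> {0..T} \<longrightarrow> norm (Y (k n) t - y t) < e)"
  proof (rule Arzela_Ascoli[of "{0..T}" Y, OF compact_Icc bound equicont])
    fix y and k :: "nat \<Rightarrow> nat"
    assume "strict_mono k"
      and "\<And>e. 0 < e \<Longrightarrow> \<exists>N. \<forall>n t. n \<ge> N \<and> t \<in> {0..T} \<longrightarrow> norm (Y (k n) t - y t) < e"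
    then show ?thesis
      by (intro exI[of _ y] exI[of _ k]) simp
  qed
  then obtain y k where k: "strict_mono (k :: nat \<Rightarrow> nat)"
    and unif: "\<And>e. 0 < e \<Longrightarrow> \<exists>N. \<forall>n t. n \<ge> N \<and> t \<in> {0..T} \<longrightarrow> norm (Y (k n) t - y t) < e"
    by blast
  have lim: "(\<lambda>n. Y (k n) t) \<longlonglongrightarrow> y t" if "t \<in> {0..T}" for t
    unfolding LIMSEQ_iff using unif that by meson
  \<comment> \<open>All conditions are non-strict inequalities between values, so they survive
    pointwise limits; in particular the cubic barrier does.\<close>
  have y: "admissible T y"
    unfolding admissible_def
  proof (intro conjI ballI)
    fix t assume t: "t \<in> {0..T}"
    show "t ^ 3 / 1152 \<le> y t"
      using bnd(1)[OF t] by (intro LIMSEQ_le_const[OF lim[OF t]]) blast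
    show "y t \<le> exp (2 * t)"
      using bnd(2)[OF t] by (intro LIMSEQ_le_const2[OF lim[OF t]]) blast
  next
    show "?L-lipschitz_on {0..T} y"
    proof (rule lipschitz_onI)
      fix s t assume st: "s \<in> {0..T}" "t \<in> {0..T}"
      show "dist (y s) (y t) \<le> ?L * dist s t"
        using lip[OF st] by (intro LIMSEQ_le_const2[OF tendsto_dist[OF lim[OF st(1)] lim[OF st(2)]]]) blast
    qed simp
  qed
  have "y t = picard y t" if t: "t \<in> {0..T}" for t
  proof -
    \<comment> \<open>The defect is the offset plus the change of \<open>picard (Y n)\<close> over a
      time at most \<open>d n\<close>; both tend to 0.\<close>
    have "dist (Y n t) (picard (Y n) t) \<le> d n ^ 3 / 288 + ?L * d n" for n
    proof -
      have "dist (picard (Y n) (max 0 (t - d n))) (picard (Y n) t)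
          \<le> ?L * dist (max 0 (t - d n)) t"
        using t d[of n] by (intro lipschitz_onD[OF lipschitz_on_picard[OF Y]]) auto
      also have "\<dots> \<le> ?L * d n"
        using t d[of n] by (intro mult_left_mono) (auto simp: dist_real_def)
      finally show ?thesis
        using zero_less_power[OF d(1)[of n], of 3] Y_eq[OF t, of n]
        unfolding delayed_picard_def dist_real_def by linarith
    qed
    then have "\<bar>Y (k n) t - picard (Y (k n)) t\<bar> \<le> d (k n) ^ 3 / 288 + ?L * d (k n)" for n
      by (simp add: dist_real_def)
    then have ev: "\<forall>\<^sub>F n in sequentially.
        norm (Y (k n) t - picard (Y (k n)) t) \<le> d (k n) ^ 3 / 288 + ?L * d (k n)"
      unfolding real_norm_def by (rule always_eventually[OF allI])
    have "d \<longlonglongrightarrow> 0"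
      unfolding d_def by (rule LIMSEQ_inverse_real_of_nat)
    then have "(\<lambda>n. d (k n)) \<longlonglongrightarrow> 0"
      using LIMSEQ_subseq_LIMSEQ[of d 0 k] k unfolding o_def by blast
    then have "(\<lambda>n. d (k n) ^ 3 / 288 + ?L * d (k n)) \<longlonglongrightarrow> 0 ^ 3 / 288 + ?L * 0"
      by (intro tendsto_add tendsto_divide tendsto_power tendsto_mult tendsto_const) simp_all
    then have "(\<lambda>n. d (k n) ^ 3 / 288 + ?L * d (k n)) \<longlonglongrightarrow> 0"
      by simp
    with ev have "(\<lambda>n. Y (k n) t - picard (Y (k n)) t) \<longlonglongrightarrow> 0"
      by (rule Lim_null_comparison)
    moreover have "(\<lambda>n. Y (k n) t - picard (Y (k n)) t) \<longlonglongrightarrow> y t - picard y t"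
      using t by (intro tendsto_diff lim tendsto_picard[OF Y y]) auto
    ultimately have "0 = y t - picard y t"
      by (rule LIMSEQ_unique)
    then show ?thesis
      by simp
  qed
  then show ?thesis
    using that y by blast
qed

section \<open>From fixed points to solutions\<close>

lemma heis_solution_lift:
  assumes y: "continuous_on {0..T} y" and eq: "\<And>t. t \<in> {0..T} \<Longrightarrow> y t = picard y t"
  shows "heis_solution (\<lambda>x. heis_X1 x + axis_dist x *\<^sub>R heis_X2 x) T (lift y)"
proof -
  let ?b = "\<lambda>x. heis_X1 x + axis_dist x *\<^sub>R heis_X2 x"
  have deriv: "(lift y has_vector_derivative ?b (lift y s)) (at s within {0..T})"
    if s: "s \<in> {0..T}" for s
  proof -
    have "(picard y has_vector_derivative axis_dist (lift y s)) (at s within {0..T})"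
      unfolding picard_def
      by (intro integral_has_vector_derivative continuous_on_axis_dist_lift y s)
    then have y': "(y has_vector_derivative axis_dist (lift y s)) (at s within {0..T})"
      using eq s has_vector_derivative_transform by blast
    have I': "((\<lambda>t. integral {0..t} y) has_vector_derivative y s) (at s within {0..T})"
      by (intro integral_has_vector_derivative y s)
    \<comment> \<open>In the third entry the product rule gives
      \<open>s * axis_dist (lift y s) + y s\<close>, and the integral term subtracts
      \<open>2 * y s\<close>.\<close>
    have "((\<lambda>t. t *\<^sub>R axis 1 1 + y t *\<^sub>R axis 2 1
            + (t * y t - 2 * integral {0..t} y) *\<^sub>R axis 3 1 :: real^3) has_vector_derivative
          (1 *\<^sub>R axis 1 1 + axis_dist (lift y s) *\<^sub>R axis 2 1
            + (s * axis_dist (lift y s) - y s) *\<^sub>R axis 3 1)) (at s within {0..T})"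
      using y' I' unfolding has_real_derivative_iff_has_vector_derivative[symmetric]
      by (auto intro!: derivative_eq_intros)
    moreover have "?b (lift y s) = vector [1, axis_dist (lift y s), s * axis_dist (lift y s) - y s]"
      by (simp add: heis_X1_def heis_X2_def vec_eq_iff forall_3 lift_def)
    ultimately show ?thesis
      by (simp only: lift_def[abs_def] vector_3_eq_axis_sum)
  qed
  have int: "((\<lambda>s. ?b (lift y s)) has_integral lift y t - lift y 0) {0..t}" if "t \<in> {0..T}" for t
    using that by (intro fundamental_theorem_of_calculus)
      (auto intro!: has_vector_derivative_within_subset[OF deriv])
  then show ?thesis
    unfolding heis_solution_def
    using continuous_on_lift[OF y] has_integral_integrable[OF int] integral_unique[OF int] by simp
qed

text \<open>The zero function is also a fixed point, since \<open>axis_dist\<close> vanishes on the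
  axis.\<close>

lemma heis_solution_axis:
  "heis_solution (\<lambda>x. heis_X1 x + axis_dist x *\<^sub>R heis_X2 x) T (\<lambda>t. vector [t, 0, 0])"
proof -
  have "lift (\<lambda>_. 0) = (\<lambda>t. vector [t, 0, 0])"
    by (simp add: lift_def fun_eq_iff)
  moreover have "picard (\<lambda>_. 0) t = 0" for t
    by (simp add: picard_def calculation axis_dist_axis)
  ultimately show ?thesis
    using heis_solution_lift[of T "\<lambda>_. 0"] by simp
qed

theorem mainTheorem5:
  fixes T :: real and a :: "real^3 \<Rightarrow> real" and b :: "real^3 \<Rightarrow> real^3"
  assumes "T > 0"
    and "a = (\<lambda>x. INF s::real. heis_dist (vector [s, 0, 0]) x)"
    and "b = (\<lambda>x. heis_X1 x + a x *\<^sub>R heis_X2 x)"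
  shows "heis_lipschitz a \<and> lipschitz_horizontal_field b \<and>
    heis_solution b T (\<lambda>t. vector [t, 0, 0]) \<and>
    (\<exists>\<gamma>. heis_solution b T \<gamma> \<and> \<gamma> 0 = 0 \<and> (\<exists>t\<in>{0..T}. \<gamma> t \<noteq> vector [t, 0, 0]))"
proof (intro conjI)
  have a: "a = axis_dist"
    using assms(2) by (simp add: axis_dist_def fun_eq_iff)
  show "heis_lipschitz a"
    by (simp add: a heis_lipschitz_axis_dist)
  moreover have "heis_lipschitz (\<lambda>_. 1)"
    unfolding heis_lipschitz_def by (auto intro: exI[of _ 0])
  ultimately show "lipschitz_horizontal_field b"
    unfolding lipschitz_horizontal_field_def assms(3)
    by (intro exI[of _ "\<lambda>_. 1"] exI[of _ a]) simp
  show "heis_solution b T (\<lambda>t. vector [t, 0, 0])"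
    unfolding assms(3) a by (rule heis_solution_axis)
  obtain y where y: "admissible T y" "\<And>t. t \<in> {0..T} \<Longrightarrow> y t = picard y t"
    using ex_picard_fixed_point[of T] by metis
  have "heis_solution b T (lift y)"
    unfolding assms(3) a
    by (intro heis_solution_lift admissible_continuous_on[OF y(1)] y(2)) auto
  \<comment> \<open>The fixed point equation forces \<open>y 0 = 0\<close>; admissibility alone
    would allow values up to 1.\<close>
  moreover have "lift y 0 = 0"
    using y(2)[of 0] \<open>T > 0\<close> by (simp add: lift_def picard_def vec_eq_iff forall_3)
  \<comment> \<open>The barrier makes the second coordinate positive at the final time.\<close>
  moreover have "lift y T \<noteq> vector [T, 0, 0]"
  proof -
    have "0 < T ^ 3 / 1152"
      using \<open>T > 0\<close> by simp
    also have "\<dots> \<le> y T"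
      using y(1) \<open>T > 0\<close> by (auto simp: admissible_def)
    finally have "lift y T $ 2 \<noteq> vector [T, 0, 0] $ (2::3)"
      by (simp add: lift_def)
    then show ?thesis by auto
  qed
  ultimately show "\<exists>\<gamma>. heis_solution b T \<gamma> \<and> \<gamma> 0 = 0 \<and> (\<exists>t\<in>{0..T}. \<gamma> t \<noteq> vector [t, 0, 0])"
    using \<open>T > 0\<close> by (intro exI[of _ "lift y"]) auto
qed

end
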